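(* Let $2\le p<\infty$ and let $f\in L^p$ be regular. Suppose that there exist functions $g_S\in L^p$, $S\subset\{1,\dots,d\}$, with $g_S\in\bigcap_{q\in S}\big(L^p(\mathcal F_0^{(q)})\ominus L^p(\mathcal F_{-1}^{(q)})\big)$, such that $$f=\sum_{S\subset\{1,\dots,d\}}\ \prod_{q\in S^c}(I-U_{\epsilon_q})\,g_S .$$ Then for every $\underline n=(n_1,\dots,n_d)\in\mathbb N^d$, $$\Big\|\sum_{\underline1\le\underline i\le\underline n}U_{\underline i}f\Big\|_p\le 2^{2d}p^{d/2}\,|\underline n|^{1/2}\sum_{S\subset\{1,\dots,d\}}\|g_S\|_p ,$$ and for every $x>0$, $$\mu\Big(\sum_{\underline1\le\underline i\le\underline n}U_{\underline i}f>x|\underline n|\Big)\le 2^{2dp}p^{dp/2}\Big(\sum_{S\subset\{1,\dots,d\}}\|g_S\|_p\Big)^p x^{-p}\,|\underline n|^{-p/2}.$$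
   Context: Let $d\ge1$, let $(\Omega,\mathcal A,\mu)$ be a probability space and $(T_{\underline i})_{\underline i\in\mathbb Z^d}$ a $\mathbb Z^d$-action on it generated by commuting invertible measure-preserving transformations $T_{\epsilon_1},\dots,T_{\epsilon_d}$, where $\epsilon_q\in\mathbb Z^d$ has $1$ at the $q$-th place and $0$ elsewhere. $U_{\underline i}f=f\circ T_{\underline i}$. $I$ is the identity operator, an empty product of operators is $I$, $S^c=\{1,\dots,d\}\setminus S$, $\underline 1=(1,\dots,1)$, $\underline i\le\underline j$ means $i_q\le j_q$ for all $q$, and $|\underline n|=n_1\cdots n_d$. Functions are real-valued. There is a completely commuting filtration $(\mathcal F_{\underline j})_{\underline j\in\mathbb Z^d}$: there is a sub-$\sigma$-algebra $\mathcal F\subset\mathcal A$ with $\mathcal F_{\underline i}=T_{-\underline i}\mathcal F$ for all $\underline i$; $\mathcal F_{\underline i}\subset\mathcal F_{\underline j}$ if $\underline i\le\underline j$; and for every integrable $f$, $E\big(E(f|\mathcal F_{i_1,\dots,i_d})\,|\,\mathcal F_{j_1,\dots,j_d}\big)=E(f|\mathcal F_{i_1\wedge j_1,\dots,i_d\wedge j_d})$. $\mathcal F_l^{(q)}$ is the $\sigma$-algebra generated by all $\mathcal F_{\underline i}$ with $i_q\le l$; $\mathcal F_{-\infty}^{(q)}=\bigcap_{k}\mathcal F_{-k}^{(q)}$; $\mathcal F_{\underline\infty}$ is the $\sigma$-algebra generated by all $\mathcal F_{\underline i}$. For $\sigma$-algebras $\mathcal G\subset\mathcal H$, $L^p(\mathcal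 H)\ominus L^p(\mathcal G)=\{h\in L^p(\mathcal H):E(h|\mathcal G)=0\}$. An integrable function $f$ is regular if it is $\mathcal F_{\underline\infty}$-measurable and $E(f|\mathcal F_{-\infty}^{(q)})=0$ for every $1\le q\le d$. *)

theory Defs
  imports "HOL-Probability.Probability"
begin

text \<open>
  The index group is \<^typ>\<open>int ^ 'd\<close> with the componentwise order of the library. The type of
  indices is nonempty and finite, and \<^term>\<open>axis q 1\<close> is the unit vector in direction \<^term>\<open>q\<close>.
\<close>

locale mp_action = prob_space M
  for M :: "'a measure" and T :: "int ^ 'd \<Rightarrow> 'a \<Rightarrow> 'a" +
  assumes T_measurable: "T i \<in> measurable M M"
    and T_preserving: "distr M M (T i) = M"
    and T_zero: "x \<in> space M \<Longrightarrow> T 0 x = x"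
    and T_add: "x \<in> space M \<Longrightarrow> T (i + j) x = T i (T j x)"

text \<open>
  The action laws are only required on \<^term>\<open>space M\<close>. Restricting \<open>f \<circ> T i\<close> to this set
  makes the operators below commute on all functions, see \<open>I_minus_U_commute\<close>.
\<close>

definition U :: "'a measure \<Rightarrow> (int ^ 'd \<Rightarrow> 'a \<Rightarrow> 'a) \<Rightarrow> int ^ 'd \<Rightarrow> ('a \<Rightarrow> real) \<Rightarrow> 'a \<Rightarrow> real"
  where "U M T i f = (\<lambda>x\<in>space M. f (T i x))"

definition I_minus_U ::
    "'a measure \<Rightarrow> (int ^ 'd \<Rightarrow> 'a \<Rightarrow> 'a) \<Rightarrow> 'd \<Rightarrow> ('a \<Rightarrow> real) \<Rightarrow> 'a \<Rightarrow> real"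
  where "I_minus_U M T q h = (\<lambda>x. h x - U M T (axis q 1) h x)"

text \<open>The product of a finite family of commuting operators.\<close>

definition op_prod :: "('i \<Rightarrow> 'b \<Rightarrow> 'b) \<Rightarrow> 'i set \<Rightarrow> 'b \<Rightarrow> 'b"
  where "op_prod A S = Finite_Set.fold (\<lambda>q B. A q \<circ> B) id S"

lemma op_prod_empty: "op_prod A {} = id"
  by (simp add: op_prod_def)

lemma op_prod_insert:
  assumes comm: "\<And>q r. A q \<circ> A r = A r \<circ> A q" and "finite S" "q \<notin> S"
  shows "op_prod A (insert q S) = A q \<circ> op_prod A S"
proof -
  interpret comp_fun_commute "\<lambda>q B. A q \<circ> B"
  proof
    fix x y
    have "A y (A x z) = A x (A y z)" for z
      using comm[of y x] by (metis comp_apply)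
    then show "(\<circ>) (A y) \<circ> (\<circ>) (A x) = (\<circ>) (A x) \<circ> (\<circ>) (A y)"
      by (simp add: fun_eq_iff)
  qed
  show ?thesis
    using assms by (simp add: op_prod_def)
qed

lemma (in mp_action) I_minus_U_commute:
  "I_minus_U M T q \<circ> I_minus_U M T r = I_minus_U M T r \<circ> I_minus_U M T q"
proof (intro ext)
  fix h :: "'a \<Rightarrow> real" and x
  show "(I_minus_U M T q \<circ> I_minus_U M T r) h x = (I_minus_U M T r \<circ> I_minus_U M T q) h x"
  proof (cases "x \<in> space M")
    case True
    then have "T i x \<in> space M" for i
      using measurable_space[OF T_measurable] by blast
    moreover have "T (axis q 1) (T (axis r 1) x) = T (axis r 1) (T (axis q 1) x)"
      using True T_add[of x "axis q 1" "axis r 1"] T_add[of x "axis r 1" "axis q 1"]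
      by (simp add: add.commute)
    ultimately show ?thesis
      using True by (simp add: I_minus_U_def U_def)
  qed (simp add: I_minus_U_def U_def)
qed

definition completely_commuting_filtration ::
    "'a measure \<Rightarrow> (int ^ 'd \<Rightarrow> 'a \<Rightarrow> 'a) \<Rightarrow> (int ^ 'd \<Rightarrow> 'a measure) \<Rightarrow> bool"
  where "completely_commuting_filtration M T F \<longleftrightarrow>
    (\<forall>i. subalgebra M (F i)) \<and>
    (\<exists>F0. subalgebra M F0 \<and> (\<forall>i. sets (F i) = (\<lambda>A. T (- i) ` A) ` sets F0)) \<and>
    (\<forall>i j. i \<le> j \<longrightarrow> sets (F i) \<subseteq> sets (F j)) \<and>
    (\<forall>f i j. integrable M f \<longrightarrow>
      (AE x in M. real_cond_exp M (F j) (real_cond_exp M (F i) f) x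
                = real_cond_exp M (F (\<chi> q. min (i $ q) (j $ q))) f x))"

text \<open>
  In this and the next two definitions, only the \<open>\<sigma>\<close>-algebra of the resulting measure is relevant.
\<close>

definition F_dir :: "'a measure \<Rightarrow> (int ^ 'd \<Rightarrow> 'a measure) \<Rightarrow> 'd \<Rightarrow> int \<Rightarrow> 'a measure"
  where "F_dir M F q l = sigma (space M) (\<Union>i\<in>{i. i $ q \<le> l}. sets (F i))"

definition F_dir_minf :: "'a measure \<Rightarrow> (int ^ 'd \<Rightarrow> 'a measure) \<Rightarrow> 'd \<Rightarrow> 'a measure"
  where "F_dir_minf M F q = sigma (space M) (\<Inter>k::nat. sets (F_dir M F q (- int k)))"

definition F_inf :: "'a measure \<Rightarrow> (int ^ 'd \<Rightarrow> 'a measure) \<Rightarrow> 'a measure"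
  where "F_inf M F = sigma (space M) (\<Union>i. sets (F i))"

text \<open>
  Measurability with respect to a sub-\<open>\<sigma>\<close>-algebra is understood up to null sets of \<^term>\<open>M\<close>, since
  the elements of the Lebesgue spaces are classes of functions modulo \<^term>\<open>M\<close>.
\<close>

definition ae_measurable :: "'a measure \<Rightarrow> 'a measure \<Rightarrow> ('a \<Rightarrow> real) \<Rightarrow> bool"
  where "ae_measurable M G f \<longleftrightarrow> (\<exists>f'\<in>borel_measurable G. AE x in M. f x = f' x)"

definition Lp :: "'a measure \<Rightarrow> real \<Rightarrow> 'a measure \<Rightarrow> ('a \<Rightarrow> real) set"
  where "Lp M p G = {f \<in> borel_measurable M.
    integrable M (\<lambda>x. \<bar>f x\<bar> powr p) \<and> ae_measurable M G f}"

definition Lp_norm :: "'a measure \<Rightarrow> real \<Rightarrow> ('a \<Rightarrow> real) \<Rightarrow> real"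
  where "Lp_norm M p f = (\<integral>x. \<bar>f x\<bar> powr p \<partial>M) powr (1 / p)"

definition Lp_minus :: "'a measure \<Rightarrow> real \<Rightarrow> 'a measure \<Rightarrow> 'a measure \<Rightarrow> ('a \<Rightarrow> real) set"
  where "Lp_minus M p H G = {h \<in> Lp M p H. AE x in M. real_cond_exp M G h x = 0}"

definition regular :: "'a measure \<Rightarrow> (int ^ 'd \<Rightarrow> 'a measure) \<Rightarrow> ('a \<Rightarrow> real) \<Rightarrow> bool"
  where "regular M F f \<longleftrightarrow> integrable M f \<and> ae_measurable M (F_inf M F) f \<and>
    (\<forall>q. AE x in M. real_cond_exp M (F_dir_minf M F q) f x = 0)"

definition vol :: "int ^ 'd \<Rightarrow> real"
  where "vol n = (\<Prod>q\<in>UNIV. real_of_int (n $ q))"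

end

theory Submission
  imports Defs
begin

text \<open>
  In one direction, the translates of a function in \<open>L\<^sup>p(\<F>\<^sub>0) \<ominus> L\<^sup>p(\<F>\<^sub>-\<^sub>1)\<close> are martingale
  differences, and a martingale with differences of norm at most \<open>b\<close> satisfies
  \<open>\<parallel>X\<^sub>n\<parallel> \<le> 2 (p n)\<^sup>1\<^sup>/\<^sup>2 b\<close>: for \<open>n \<le> 4 p\<close> this is the triangle inequality, and afterwards it
  propagates by the second-order bound of \<open>E|X + Y|\<^sup>p\<close>, whose linear term vanishes. Summing over the
  directions in \<open>S\<close> one after another keeps the martingale property in the other directions, because
  translates along one axis preserve the directional \<open>\<sigma>\<close>-algebras of the others. The sums over the
  directions in the complement of \<open>S\<close> telescope and cost a factor 2 each.
\<close>

section \<open>Elementary inequalities for real powers\<close>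

lemma convex_on_powr_nonneg:
  fixes p :: real
  assumes "1 \<le> p"
  shows "convex_on {0..} (\<lambda>x. x powr p)"
proof (rule convex_onI)
  fix t x y :: real
  assume t: "0 < t" "t < 1" and xy: "x \<in> {0..}" "y \<in> {0..}"
  \<comment> \<open>If one of the two points is 0, convexity reduces to this scaling inequality; two
    positive points are left to \<open>powr_convex\<close>.\<close>
  have scale: "(c * z) powr p \<le> c * z powr p" if "0 \<le> c" "c \<le> 1" "0 \<le> z" for c z
  proof -
    have "c powr p \<le> c"
      using that assms powr_le_one_le[of c p] by (cases "c = 0") auto
    then show ?thesis
      using that by (simp add: powr_mult mult_right_mono)
  qed
  consider "x = 0" | "y = 0" | "0 < x" "0 < y"
    using xy by force
  then show "((1 - t) *\<^sub>R x + t *\<^sub>R y) powr p \<le> (1 - t) * x powr p + t * y powr p"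
  proof cases
    case 3
    then show ?thesis
      using convex_onD[OF powr_convex[OF assms], of t x y] t by simp
  qed (use scale[of t y] scale[of "1 - t" x] t xy in auto)
qed simp

text \<open>Young's inequality for the exponents \<open>p / (p - 1)\<close> and \<open>p\<close>,
  cleared of denominators. Equivalently, \<open>y powr p\<close> lies above its tangent at
  \<open>x\<close>.\<close>

lemma Youngs_inequality_powr:
  fixes p x y :: real
  assumes "1 < p" "0 \<le> x" "0 \<le> y"
  shows "p * (x powr (p - 1) * y) \<le> (p - 1) * x powr p + y powr p"
proof -
  have "x powr (p - 1) * y \<le> (x powr (p - 1)) powr (p / (p - 1)) / (p / (p - 1)) + y powr p / p"
    by (rule Youngs_inequality) (use assms in \<open>auto simp: field_simps\<close>)
  also have "(x powr (p - 1)) powr (p / (p - 1)) = x powr p"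
    using assms by (simp add: powr_powr)
  finally show ?thesis
    using assms by (simp add: field_simps)
qed

text \<open>Weighted arithmetic-geometric mean of \<open>x powr p\<close> and
  \<open>y powr p\<close> with weights \<open>(p - 2) / p\<close> and \<open>2 / p\<close>; at
  \<open>p = 2\<close> the first weight is simply 0.\<close>

lemma Youngs_inequality_square:
  fixes p x y :: real
  assumes "2 \<le> p" "0 \<le> x" "0 \<le> y"
  shows "x powr (p - 2) * y\<^sup>2 \<le> (p - 2) / p * x powr p + 2 / p * y powr p"
proof (cases "x = 0 \<or> y = 0")
  case False
  then have pos: "0 < x" "0 < y"
    using assms by auto
  have "(x powr p) powr ((p - 2) / p) * (y powr p) powr (2 / p)
      \<le> (p - 2) / p * x powr p + 2 / p * y powr p"
    by (rule Youngs_inequality_0) (use assms pos in \<open>auto simp: field_simps\<close>)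
  then show ?thesis
    using assms pos by (simp add: powr_powr powr_numeral)
qed (use assms in auto)

lemma powr_diff_le:
  fixes q u v m :: real
  assumes "1 \<le> q" "0 \<le> v" "v \<le> u" "u \<le> m"
  shows "u powr q - v powr q \<le> q * (u - v) * m powr (q - 1)"
\<comment> \<open>The mean value theorem is applied on a proper interval of positive numbers; the
  two degenerate cases are checked directly.\<close>
proof (cases "v = 0 \<or> u = v")
  case True
  have "u powr q = u * u powr (q - 1)"
    using powr_add[of u 1 "q - 1"] assms by simp
  also have "\<dots> \<le> q * u * m powr (q - 1)"
    using assms by (intro mult_mono powr_mono2) (auto simp: mult_le_cancel_right1)
  finally show ?thesis
    using True by auto
next
  case False
  have "\<exists>z. v < z \<and> z < u \<and> u powr q - v powr q = (u - v) * (q * z powr (q - 1))"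
    using False assms by (intro MVT2) (auto intro!: derivative_eq_intros)
  then obtain z where z: "v < z" "z < u" "u powr q - v powr q = (u - v) * (q * z powr (q - 1))"
    by blast
  have "(u - v) * (q * z powr (q - 1)) \<le> (u - v) * (q * m powr (q - 1))"
    using z assms by (intro mult_left_mono powr_mono2) auto
  then show ?thesis
    using z by (simp add: algebra_simps)
qed

text \<open>Away from 0 the signed power has slope \<open>q * \<bar>t\<bar> powr (q - 1)\<close> at
  \<open>t\<close>, which is at most \<open>q * m powr (q - 1)\<close> if
  \<open>\<bar>t\<bar> \<le> m\<close>. For arguments of opposite sign the interval is split at
  0.\<close>

lemma sgn_powr_diff_le:
  fixes q u v m :: real
  assumes "1 \<le> q" "\<bar>u\<bar> \<le> m" "\<bar>v\<bar> \<le> m"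
  shows "\<bar>sgn u * \<bar>u\<bar> powr q - sgn v * \<bar>v\<bar> powr q\<bar> \<le> q * \<bar>u - v\<bar> * m powr (q - 1)"
proof -
  have same: "\<bar>s powr q - t powr q\<bar> \<le> q * \<bar>s - t\<bar> * m powr (q - 1)"
    if "0 \<le> s" "0 \<le> t" "s \<le> m" "t \<le> m" for s t
  proof (cases "s \<le> t")
    case True
    then have "s powr q \<le> t powr q"
      using that assms by (intro powr_mono2) auto
    then show ?thesis
      using powr_diff_le[of q s t m] True that assms by simp
  next
    case False
    then have "t powr q \<le> s powr q"
      using that assms by (intro powr_mono2) auto
    then show ?thesis
      using powr_diff_le[of q t s m] False that assms by simp
  qed
  have opposite: "s powr q + t powr q \<le> q * (s + t) * m powr (q - 1)"
    if "0 \<le> s" "0 \<le> t" "s \<le> m" "t \<le> m" for s t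
    using powr_diff_le[of q 0 s m] powr_diff_le[of q 0 t m] that assms
    by (simp add: algebra_simps)
  consider "0 \<le> u" "0 \<le> v" | "u \<le> 0" "v \<le> 0" | "0 < u" "v < 0" | "u < 0" "0 < v"
    by linarith
  then show ?thesis
  proof cases
    case 1
    then show ?thesis
      using same[of u v] assms by (cases "u = 0"; cases "v = 0"; simp)
  next
    case 2
    then show ?thesis
      using same[of "- u" "- v"] assms
      by (cases "u = 0"; cases "v = 0"; simp add: abs_minus_commute)
  next
    case 3
    then show ?thesis
      using opposite[of u "- v"] assms by simp
  next
    case 4
    then show ?thesis
      using opposite[of "- u" v] assms
      by simp (use powr_ge_zero[of "- u" q] powr_ge_zero[of v q] in linarith)
  qed
qed

text \<open>With \<open>s\<close> the signed power of exponent \<open>p - 1\<close>,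
  \<open>p * s t\<close> is the derivative of \<open>\<bar>t\<bar> powr p\<close>. The tangent at
  \<open>x + y\<close> gives the bound with slope \<open>s (x + y)\<close>, and the Lipschitz
  estimate for signed powers trades this slope for \<open>s x\<close>. The linear term is kept exact
  because its integral vanishes when \<open>y\<close> is a martingale difference.\<close>

lemma abs_powr_add_le:
  fixes p x y :: real
  assumes "2 \<le> p"
  shows "\<bar>x + y\<bar> powr p \<le> \<bar>x\<bar> powr p + p * (sgn x * \<bar>x\<bar> powr (p - 1) * y)
    + p * (p - 1) * ((\<bar>x\<bar> + \<bar>y\<bar>) powr (p - 2) * y\<^sup>2)"
proof -
  define s where "s t = sgn t * \<bar>t\<bar> powr (p - 1)" for t :: real
  have mult_self: "s z * z = \<bar>z\<bar> powr p" for z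
    using powr_add[of "\<bar>z\<bar>" "p - 1" 1] by (simp add: s_def sgn_if)
  have "s (x + y) * x \<le> \<bar>s (x + y)\<bar> * \<bar>x\<bar>"
    by (metis abs_ge_self abs_mult)
  also have "\<dots> \<le> \<bar>x + y\<bar> powr (p - 1) * \<bar>x\<bar>"
    by (intro mult_right_mono) (auto simp: s_def abs_mult sgn_if)
  finally have "p * (s (x + y) * x) \<le> (p - 1) * \<bar>x + y\<bar> powr p + \<bar>x\<bar> powr p"
    using Youngs_inequality_powr[of p "\<bar>x + y\<bar>" "\<bar>x\<bar>"] assms
    by (smt (verit, best) mult_left_mono)
  then have "\<bar>x + y\<bar> powr p \<le> \<bar>x\<bar> powr p + p * (s (x + y) * y)"
    using arg_cong[OF mult_self[of "x + y"], of "(*) p"] by (simp add: algebra_simps)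
  also have "s (x + y) * y \<le> s x * y + (p - 1) * ((\<bar>x\<bar> + \<bar>y\<bar>) powr (p - 2) * y\<^sup>2)"
  proof -
    have "(s (x + y) - s x) * y \<le> \<bar>s (x + y) - s x\<bar> * \<bar>y\<bar>"
      by (metis abs_ge_self abs_mult)
    also have "\<dots> \<le> ((p - 1) * \<bar>y\<bar> * (\<bar>x\<bar> + \<bar>y\<bar>) powr (p - 2)) * \<bar>y\<bar>"
      using sgn_powr_diff_le[of "p - 1" "x + y" "\<bar>x\<bar> + \<bar>y\<bar>" x] assms
      by (intro mult_right_mono) (auto simp: s_def diff_diff_eq)
    also have "\<dots> = (p - 1) * ((\<bar>x\<bar> + \<bar>y\<bar>) powr (p - 2) * \<bar>y\<bar>\<^sup>2)"
      unfolding power2_eq_square by (simp only: mult_ac)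
    finally show ?thesis
      by (simp add: left_diff_distrib)
  qed
  finally show ?thesis
    using assms by (simp add: s_def algebra_simps)
qed

text \<open>The tangent of the power at 1, that is, \<open>Youngs_inequality_powr\<close> at 1 and
  \<open>1 + x\<close>; for the exponent 1 there is equality.\<close>

lemma Bernoulli_inequality_powr:
  fixes q x :: real
  assumes "1 \<le> q" "0 \<le> x"
  shows "1 + q * x \<le> (1 + x) powr q"
proof (cases "q = 1")
  case False
  then show ?thesis
    using Youngs_inequality_powr[of q 1 "1 + x"] assms by (simp add: algebra_simps)
qed (use assms in auto)

lemma power2_powr_half:
  fixes p z :: real
  assumes "0 < z"
  shows "(z\<^sup>2) powr (p / 2) = z powr p"
  using powr_powr[of z 2 "p / 2"] assms by (simp add: powr_numeral)

text \<open>
  The growth of the function \<open>r\<^sup>2 \<mapsto> r powr p\<close> over a step of length \<open>4 * p\<close> absorbs the error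
  term of \<open>abs_powr_add_le\<close>.
\<close>

lemma powr_step_le:
  fixes p r :: real
  assumes "2 \<le> p" "2 * p \<le> r"
  shows "r powr p + p * (p - 1) * (r + 1) powr (p - 2) \<le> (r\<^sup>2 + 4 * p) powr (p / 2)"
proof -
  have r: "0 < r"
    using assms by simp
  have eq: "(r\<^sup>2) powr (p / 2) = r powr p"
    using r by (rule power2_powr_half)
  \<comment> \<open>From \<open>2 * p \<le> r\<close> the exponent \<open>(p - 2) / r\<close> is at
    most 1/2, so replacing \<open>r\<close> by \<open>r + 1\<close> costs at most a factor
    2.\<close>
  have "(1 + 1 / r) powr (p - 2) \<le> exp (1 / r) powr (p - 2)"
    using assms r by (intro powr_mono2 exp_ge_add_one_self) auto
  also have "\<dots> = exp ((p - 2) / r)"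
    by (simp add: powr_def)
  also have "\<dots> \<le> exp (1 / 2)"
    using assms r by (simp add: field_simps)
  also have "exp (1 / 2 :: real) \<le> 2"
    using exp_bound_half[of "1/2 :: real"] by simp
  finally have e: "(1 + 1 / r) powr (p - 2) \<le> 2" .
  have "(r + 1) powr (p - 2) = (r * (1 + 1 / r)) powr (p - 2)"
    using r by (simp add: distrib_left)
  also have "\<dots> = r powr (p - 2) * (1 + 1 / r) powr (p - 2)"
    using r by (subst powr_mult) auto
  also have "\<dots> \<le> r powr (p - 2) * 2"
    using e by (intro mult_left_mono) auto
  also have "r powr (p - 2) = r powr p / r\<^sup>2"
    using r by (simp add: powr_diff flip: powr_numeral)
  finally have "p * (p - 1) * (r + 1) powr (p - 2) \<le> p * (p - 1) * (r powr p / r\<^sup>2 * 2)"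
    using assms by (intro mult_left_mono) auto
  also have "\<dots> \<le> p * p * (r powr p / r\<^sup>2 * 2)"
    using assms by (intro mult_right_mono mult_left_mono) auto
  \<comment> \<open>The relative error \<open>2 * p * p / r\<^sup>2\<close> is written as
    \<open>p / 2\<close> times \<open>4 * p / r\<^sup>2\<close>, ready for Bernoulli's inequality
    with exponent \<open>p / 2\<close>; this is where the step length \<open>4 * p\<close> comes
    from.\<close>
  finally have "r powr p + p * (p - 1) * (r + 1) powr (p - 2) \<le> r powr p * (1 + p / 2 * (4 * p / r\<^sup>2))"
    using r by (simp add: algebra_simps)
  also have "\<dots> \<le> r powr p * (1 + 4 * p / r\<^sup>2) powr (p / 2)"
    using assms by (intro mult_left_mono Bernoulli_inequality_powr) auto
  also have "\<dots> = (r\<^sup>2 * (1 + 4 * p / r\<^sup>2)) powr (p / 2)"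
    using assms by (subst powr_mult) (auto simp: eq)
  also have "r\<^sup>2 * (1 + 4 * p / r\<^sup>2) = r\<^sup>2 + 4 * p"
    using r by (simp add: field_simps)
  finally show ?thesis .
qed

section \<open>The Lp seminorm and Minkowski's inequality\<close>

lemma Lp_iff: "f \<in> Lp M p M \<longleftrightarrow> f \<in> borel_measurable M \<and> integrable M (\<lambda>x. \<bar>f x\<bar> powr p)"
  by (auto simp: Lp_def ae_measurable_def)

lemma Lp_subset: "Lp M p G \<subseteq> Lp M p M"
  unfolding subset_iff Lp_iff by (auto simp: Lp_def)

lemma Lp_mono:
  assumes "subalgebra M G" "subalgebra M H" "sets G \<subseteq> sets H"
  shows "Lp M p G \<subseteq> Lp M p H"
proof -
  have "subalgebra H G"
    using assms by (simp add: subalgebra_def)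
  then show ?thesis
    by (auto simp: Lp_def ae_measurable_def dest: measurable_from_subalg)
qed

lemma Lp_measurable: "f \<in> Lp M p G \<Longrightarrow> f \<in> borel_measurable M"
  by (simp add: Lp_def)

lemma Lp_integrable_powr: "f \<in> Lp M p G \<Longrightarrow> integrable M (\<lambda>x. \<bar>f x\<bar> powr p)"
  by (simp add: Lp_def)

lemma Lp_norm_nonneg: "0 \<le> Lp_norm M p f"
  by (simp add: Lp_norm_def)

lemma Lp_norm_powr: "0 < p \<Longrightarrow> Lp_norm M p f powr p = (\<integral>x. \<bar>f x\<bar> powr p \<partial>M)"
  by (simp add: Lp_norm_def powr_powr)

lemma Lp_norm_leI:
  assumes "0 < p" "0 \<le> a" "(\<integral>x. \<bar>f x\<bar> powr p \<partial>M) \<le> a powr p"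
  shows "Lp_norm M p f \<le> a"
proof -
  have "Lp_norm M p f \<le> (a powr p) powr (1 / p)"
    unfolding Lp_norm_def using assms by (intro powr_mono2) auto
  then show ?thesis
    using assms by (simp add: powr_powr)
qed

lemma integral_powr_le:
  assumes "0 < p" "Lp_norm M p f \<le> a"
  shows "(\<integral>x. \<bar>f x\<bar> powr p \<partial>M) \<le> a powr p"
  using powr_mono2[of p "Lp_norm M p f" a] assms by (simp add: Lp_norm_powr Lp_norm_nonneg)

lemma Lp_norm_cong_AE:
  assumes "f \<in> borel_measurable M" "h \<in> borel_measurable M" "AE x in M. f x = h x"
  shows "Lp_norm M p f = Lp_norm M p h"
proof -
  have "(\<integral>x. \<bar>f x\<bar> powr p \<partial>M) = (\<integral>x. \<bar>h x\<bar> powr p \<partial>M)"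
    using assms by (intro integral_cong_AE) auto
  then show ?thesis
    by (simp add: Lp_norm_def)
qed

lemma Lp_norm_zero: "Lp_norm M p (\<lambda>_. 0) = 0"
  by (simp add: Lp_norm_def)

lemma Lp_norm_uminus: "Lp_norm M p (\<lambda>x. - f x) = Lp_norm M p f"
  by (simp add: Lp_norm_def)

text \<open>Convexity of the power at \<open>\<bar>x\<bar> / a\<close> and
  \<open>\<bar>y\<bar> / b\<close>, with weights proportional to \<open>a\<close> and
  \<open>b\<close>. Integrated with \<open>a\<close> and \<open>b\<close> at least the norms it
  yields Minkowski's inequality; with \<open>a = b = 1\<close> it shows that \<open>Lp\<close> is
  closed under addition.\<close>

lemma abs_add_powr_le:
  fixes a b p x y :: real
  assumes "1 \<le> p" "0 < a" "0 < b"
  shows "\<bar>x + y\<bar> powr p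
    \<le> (a + b) powr p * (a / (a + b) * (\<bar>x\<bar> powr p / a powr p) + b / (a + b) * (\<bar>y\<bar> powr p / b powr p))"
proof -
  define t where "t = b / (a + b)"
  have t: "0 \<le> t" "t \<le> 1" "1 - t = a / (a + b)"
    using assms by (auto simp: t_def field_simps)
  have "a + b \<noteq> 0"
    using assms by simp
  then have "\<bar>x\<bar> + \<bar>y\<bar> = (a + b) * ((1 - t) * (\<bar>x\<bar> / a) + t * (\<bar>y\<bar> / b))"
    unfolding t(3) unfolding t_def using assms by (simp add: distrib_left)
  then have "\<bar>x + y\<bar> powr p \<le> ((a + b) * ((1 - t) * (\<bar>x\<bar> / a) + t * (\<bar>y\<bar> / b))) powr p"
    using assms by (intro powr_mono2) (auto intro: order_trans[OF abs_triangle_ineq])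
  also have "\<dots> = (a + b) powr p * ((1 - t) * (\<bar>x\<bar> / a) + t * (\<bar>y\<bar> / b)) powr p"
    by (rule powr_mult)
  also have "\<dots> \<le> (a + b) powr p * ((1 - t) * (\<bar>x\<bar> / a) powr p + t * (\<bar>y\<bar> / b) powr p)"
    using convex_onD[OF convex_on_powr_nonneg[OF assms(1)], of t "\<bar>x\<bar> / a" "\<bar>y\<bar> / b"] assms t
    by (intro mult_left_mono) auto
  finally show ?thesis
    using assms t(3) by (simp add: powr_divide t_def)
qed

lemma ae_measurable_add:
  assumes "ae_measurable M G f" "ae_measurable M G h"
  shows "ae_measurable M G (\<lambda>x. f x + h x)"
proof -
  obtain f' h' where "f' \<in> borel_measurable G" "AE x in M. f x = f' x"
    "h' \<in> borel_measurable G" "AE x in M. h x = h' x"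
    using assms by (auto simp: ae_measurable_def)
  then show ?thesis
    unfolding ae_measurable_def by (intro bexI[of _ "\<lambda>x. f' x + h' x"]) auto
qed

lemma Lp_add:
  assumes "1 \<le> p" "f \<in> Lp M p G" "h \<in> Lp M p G"
  shows "(\<lambda>x. f x + h x) \<in> Lp M p G"
proof -
  have [measurable]: "f \<in> borel_measurable M" "h \<in> borel_measurable M"
    using assms by (auto simp: Lp_def)
  have "integrable M (\<lambda>x. \<bar>f x + h x\<bar> powr p)"
  proof (rule Bochner_Integration.integrable_bound)
    show "integrable M (\<lambda>x. 2 powr p * (1 / 2 * \<bar>f x\<bar> powr p + 1 / 2 * \<bar>h x\<bar> powr p))"
      using assms by (auto simp: Lp_def)
    show "AE x in M. norm (\<bar>f x + h x\<bar> powr p)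
        \<le> norm (2 powr p * (1 / 2 * \<bar>f x\<bar> powr p + 1 / 2 * \<bar>h x\<bar> powr p))"
      using abs_add_powr_le[OF assms(1), of 1 1] by simp
  qed simp
  then show ?thesis
    using assms by (auto simp: Lp_def intro: ae_measurable_add)
qed

lemma Lp_uminus:
  assumes "f \<in> Lp M p G"
  shows "(\<lambda>x. - f x) \<in> Lp M p G"
proof -
  have "ae_measurable M G (\<lambda>x. - f x)" if f: "ae_measurable M G f"
  proof -
    obtain f' where "f' \<in> borel_measurable G" "AE x in M. f x = f' x"
      using f by (auto simp: ae_measurable_def)
    then show ?thesis
      unfolding ae_measurable_def by (intro bexI[of _ "\<lambda>x. - f' x"]) auto
  qed
  then show ?thesis
    using assms by (simp add: Lp_def)
qed

lemma Lp_zero: "(\<lambda>_. 0) \<in> Lp M p G"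
  unfolding Lp_def ae_measurable_def by (simp, rule bexI[of _ "\<lambda>_. 0"]) simp_all

lemma Lp_sum:
  assumes "1 \<le> p" "\<And>i. i \<in> I \<Longrightarrow> f i \<in> Lp M p G"
  shows "(\<lambda>x. \<Sum>i\<in>I. f i x) \<in> Lp M p G"
  using assms(2)
proof (induction I rule: infinite_finite_induct)
  case (insert i I)
  then have "(\<lambda>x. f i x + (\<Sum>i\<in>I. f i x)) \<in> Lp M p G"
    by (intro Lp_add[OF assms(1)]) simp_all
  with insert show ?case
    by simp
qed (simp_all add: Lp_zero)

lemma Lp_norm_add_le:
  assumes "1 \<le> p" "f \<in> Lp M p M" "h \<in> Lp M p M"
  shows "Lp_norm M p (\<lambda>x. f x + h x) \<le> Lp_norm M p f + Lp_norm M p h"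
proof (rule field_le_epsilon)
  fix e :: real assume "0 < e"
  \<comment> \<open>The two halves of \<open>e\<close> keep \<open>a\<close> and \<open>b\<close>
    positive even if a norm is 0.\<close>
  define a b where "a = Lp_norm M p f + e / 2" and "b = Lp_norm M p h + e / 2"
  have ab: "0 < a" "0 < b" "Lp_norm M p f \<le> a" "Lp_norm M p h \<le> b"
    using \<open>0 < e\<close> Lp_norm_nonneg[of M p f] Lp_norm_nonneg[of M p h] by (auto simp: a_def b_def)
  have int: "integrable M (\<lambda>x. \<bar>f x\<bar> powr p)" "integrable M (\<lambda>x. \<bar>h x\<bar> powr p)"
    using assms by (auto simp: Lp_def)
  have le1: "(\<integral>x. \<bar>f x\<bar> powr p \<partial>M) / a powr p \<le> 1" "(\<integral>x. \<bar>h x\<bar> powr p \<partial>M) / b powr p \<le> 1"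
    using integral_powr_le[of p M f a] integral_powr_le[of p M h b] assms ab by simp_all
  have "(\<integral>x. \<bar>f x + h x\<bar> powr p \<partial>M) \<le> (\<integral>x. (a + b) powr p *
      (a / (a + b) * (\<bar>f x\<bar> powr p / a powr p) + b / (a + b) * (\<bar>h x\<bar> powr p / b powr p)) \<partial>M)"
    using assms int Lp_integrable_powr[OF Lp_add[OF assms]]
    by (intro integral_mono abs_add_powr_le ab) auto
  also have "\<dots> = (a + b) powr p * (a / (a + b) * ((\<integral>x. \<bar>f x\<bar> powr p \<partial>M) / a powr p)
      + b / (a + b) * ((\<integral>x. \<bar>h x\<bar> powr p \<partial>M) / b powr p))"
    using int by simp
  also have "\<dots> \<le> (a + b) powr p * (a / (a + b) * 1 + b / (a + b) * 1)"
    using le1 ab by (intro mult_left_mono add_mono) auto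
  also have "\<dots> = (a + b) powr p"
    using ab by (simp flip: add_divide_distrib)
  finally have "Lp_norm M p (\<lambda>x. f x + h x) \<le> a + b"
    using assms ab by (intro Lp_norm_leI) auto
  then show "Lp_norm M p (\<lambda>x. f x + h x) \<le> Lp_norm M p f + Lp_norm M p h + e"
    by (simp add: a_def b_def)
qed

lemma Lp_norm_diff_le:
  assumes "1 \<le> p" "f \<in> Lp M p M" "h \<in> Lp M p M"
  shows "Lp_norm M p (\<lambda>x. f x - h x) \<le> Lp_norm M p f + Lp_norm M p h"
  using Lp_norm_add_le[OF assms(1,2) Lp_uminus[OF assms(3)]] by (simp add: Lp_norm_uminus)

lemma Lp_norm_sum_le:
  assumes "1 \<le> p" "\<And>i. i \<in> I \<Longrightarrow> f i \<in> Lp M p M"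
  shows "Lp_norm M p (\<lambda>x. \<Sum>i\<in>I. f i x) \<le> (\<Sum>i\<in>I. Lp_norm M p (f i))"
  using assms(2)
proof (induction I rule: infinite_finite_induct)
  case (insert i I)
  then have "Lp_norm M p (\<lambda>x. f i x + (\<Sum>i\<in>I. f i x)) \<le> Lp_norm M p (f i) + Lp_norm M p (\<lambda>x. \<Sum>i\<in>I. f i x)"
    by (intro Lp_norm_add_le Lp_sum assms(1)) auto
  with insert show ?case
    by simp
qed (simp_all add: Lp_norm_zero)

lemma (in finite_measure) Lp_integrable:
  assumes "1 \<le> p" "f \<in> Lp M p G"
  shows "integrable M f"
proof (rule Bochner_Integration.integrable_bound)
  show "integrable M (\<lambda>x. 1 + \<bar>f x\<bar> powr p)"
    using assms by (auto simp: Lp_def)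
  have "\<bar>t\<bar> \<le> 1 + \<bar>t\<bar> powr p" for t :: real
    using powr_mono[of 1 p "\<bar>t\<bar>"] assms(1) by (cases "\<bar>t\<bar> \<le> 1") (auto intro: order_trans)
  then show "AE x in M. norm (f x) \<le> norm (1 + \<bar>f x\<bar> powr p)"
    by simp
qed (use assms in \<open>simp add: Lp_def\<close>)

section \<open>The moment inequality for martingales\<close>

text \<open>The signed power of \<open>X\<close> can be pulled out of the conditional expectation of
  \<open>Y\<close>, which vanishes; the product is integrable by Young's inequality. This disposes
  of the linear term of \<open>abs_powr_add_le\<close>.\<close>

lemma (in finite_measure) integral_sgn_powr_mult_eq_0:
  assumes "subalgebra M G" "1 < p" "X \<in> Lp M p G" "Y \<in> Lp M p M"
    and "AE x in M. real_cond_exp M G Y x = 0"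
  shows "integrable M (\<lambda>x. sgn (X x) * \<bar>X x\<bar> powr (p - 1) * Y x)" (is "integrable M ?h")
    and "(\<integral>x. sgn (X x) * \<bar>X x\<bar> powr (p - 1) * Y x \<partial>M) = 0"
proof -
  interpret G: finite_measure_subalgebra M G
    by unfold_locales fact
  have [measurable]: "X \<in> borel_measurable M" "Y \<in> borel_measurable M"
    using assms by (auto simp: Lp_def)
  \<comment> \<open>Membership in \<open>Lp M p G\<close> gives measurability only up to a null set,
    so \<open>X\<close> is replaced by a representative that is truly measurable for
    \<open>G\<close>.\<close>
  obtain X' where [measurable]: "X' \<in> borel_measurable G" and X': "AE x in M. X x = X' x"
    using assms by (auto simp: Lp_def ae_measurable_def)
  have [measurable]: "X' \<in> borel_measurable M"
    by (rule measurable_from_subalg[OF assms(1)]) fact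
  show int: "integrable M ?h"
  proof (rule Bochner_Integration.integrable_bound)
    show "integrable M (\<lambda>x. ((p - 1) * \<bar>X x\<bar> powr p + \<bar>Y x\<bar> powr p) / p)"
      using assms by (auto simp: Lp_def)
    have "\<bar>sgn u * \<bar>u\<bar> powr (p - 1) * v\<bar> \<le> ((p - 1) * \<bar>u\<bar> powr p + \<bar>v\<bar> powr p) / p" for u v :: real
      using Youngs_inequality_powr[of p "\<bar>u\<bar>" "\<bar>v\<bar>"] assms(2)
      by (auto simp: abs_mult sgn_if field_simps)
    then show "AE x in M. norm (?h x) \<le> norm (((p - 1) * \<bar>X x\<bar> powr p + \<bar>Y x\<bar> powr p) / p)"
      unfolding real_norm_def by (intro AE_I2 order_trans[OF _ abs_ge_self])
  qed measurable
  have eq: "AE x in M. ?h x = sgn (X' x) * \<bar>X' x\<bar> powr (p - 1) * Y x"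
    using X' by eventually_elim simp
  have "integrable M (\<lambda>x. sgn (X' x) * \<bar>X' x\<bar> powr (p - 1) * Y x)"
    by (rule Bochner_Integration.integrable_cong_AE_imp[OF int]) (use eq in \<open>auto elim: AE_mp\<close>)
  then have "(\<integral>x. sgn (X' x) * \<bar>X' x\<bar> powr (p - 1) * Y x \<partial>M)
      = (\<integral>x. sgn (X' x) * \<bar>X' x\<bar> powr (p - 1) * real_cond_exp M G Y x \<partial>M)"
    by (intro G.real_cond_exp_intg(2)[symmetric]) measurable
  also have "\<dots> = (\<integral>x. 0 \<partial>M)"
    by (rule integral_cong_AE) (use assms(5) in \<open>auto elim: AE_mp\<close>)
  finally show "(\<integral>x. ?h x \<partial>M) = 0"
    using integral_cong_AE[OF _ _ eq] by simp
qed

text \<open>Hoelder's inequality with exponents \<open>p / (p - 2)\<close> and \<open>p / 2\<close>,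
  obtained by integrating \<open>Youngs_inequality_square\<close> for
  \<open>\<bar>X x\<bar> / a\<close> and \<open>\<bar>Y x\<bar> / b\<close>.\<close>

lemma integral_powr_square_le:
  assumes "2 \<le> p" "X \<in> Lp M p M" "Y \<in> Lp M p M"
    and "0 < a" "0 < b" "Lp_norm M p X \<le> a" "Lp_norm M p Y \<le> b"
  shows "integrable M (\<lambda>x. \<bar>X x\<bar> powr (p - 2) * (Y x)\<^sup>2)" (is "integrable M ?h")
    and "(\<integral>x. \<bar>X x\<bar> powr (p - 2) * (Y x)\<^sup>2 \<partial>M) \<le> a powr (p - 2) * b\<^sup>2"
proof -
  have [measurable]: "X \<in> borel_measurable M" "Y \<in> borel_measurable M"
    using assms by (auto simp: Lp_def)
  have intX: "integrable M (\<lambda>x. \<bar>X x\<bar> powr p)" and intY: "integrable M (\<lambda>x. \<bar>Y x\<bar> powr p)"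
    using assms by (auto simp: Lp_def)
  \<comment> \<open>\<open>C\<close> is the claimed bound; the integral of the majorant
    \<open>B\<close> is at most \<open>C\<close> because the weights \<open>(p - 2) / p\<close> and
    \<open>2 / p\<close> add up to 1.\<close>
  define C where "C = a powr (p - 2) * b\<^sup>2"
  define B where "B x = C * ((p - 2) / p * (\<bar>X x\<bar> powr p / a powr p) + 2 / p * (\<bar>Y x\<bar> powr p / b powr p))" for x
  have intB: "integrable M B"
    unfolding B_def using intX intY by auto
  have le: "?h x \<le> B x" for x
  proof -
    have "?h x = C * ((\<bar>X x\<bar> / a) powr (p - 2) * (\<bar>Y x\<bar> / b)\<^sup>2)"
      using assms by (simp add: C_def powr_divide power_divide)
    also have "\<dots> \<le> C * ((p - 2) / p * (\<bar>X x\<bar> / a) powr p + 2 / p * (\<bar>Y x\<bar> / b) powr p)"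
      using assms by (intro mult_left_mono Youngs_inequality_square) (auto simp: C_def)
    also have "\<dots> = B x"
      using assms by (simp add: B_def powr_divide)
    finally show ?thesis .
  qed
  show int: "integrable M ?h"
    by (rule Bochner_Integration.integrable_bound[OF intB])
      (auto intro: order_trans[OF le abs_ge_self])
  have le1: "(\<integral>x. \<bar>X x\<bar> powr p \<partial>M) / a powr p \<le> 1" "(\<integral>x. \<bar>Y x\<bar> powr p \<partial>M) / b powr p \<le> 1"
    using integral_powr_le[of p M X a] integral_powr_le[of p M Y b] assms by simp_all
  have "(\<integral>x. ?h x \<partial>M) \<le> (\<integral>x. B x \<partial>M)"
    by (rule integral_mono[OF int intB le])
  also have "\<dots> = C * ((p - 2) / p * ((\<integral>x. \<bar>X x\<bar> powr p \<partial>M) / a powr p)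
      + 2 / p * ((\<integral>x. \<bar>Y x\<bar> powr p \<partial>M) / b powr p))"
    unfolding B_def using intX intY by simp
  also have "\<dots> \<le> C * ((p - 2) / p * 1 + 2 / p * 1)"
    using le1 assms by (intro mult_left_mono add_mono) (auto simp: C_def)
  also have "\<dots> = C"
    using assms by (simp add: field_simps)
  finally show "(\<integral>x. ?h x \<partial>M) \<le> a powr (p - 2) * b\<^sup>2"
    by (simp add: C_def)
qed

lemma Lp_abs: "f \<in> Lp M p M \<Longrightarrow> (\<lambda>x. \<bar>f x\<bar>) \<in> Lp M p M"
  by (auto simp: Lp_iff)

lemma Lp_norm_abs: "Lp_norm M p (\<lambda>x. \<bar>f x\<bar>) = Lp_norm M p f"
  by (simp add: Lp_norm_def)

text \<open>This is \<open>abs_powr_add_le\<close> integrated: the linear term drops out, and the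
  remainder is controlled by \<open>integral_powr_square_le\<close> with
  \<open>\<bar>X x\<bar> + \<bar>Y x\<bar>\<close> as first function, whose norm is at most
  \<open>a + b\<close>.\<close>

lemma (in finite_measure) Lp_martingale_step:
  assumes "subalgebra M G" "2 \<le> p" "X \<in> Lp M p G" "Y \<in> Lp M p M"
    and "AE x in M. real_cond_exp M G Y x = 0"
    and "0 \<le> a" "0 < b" "Lp_norm M p X \<le> a" "Lp_norm M p Y \<le> b"
  shows "Lp_norm M p (\<lambda>x. X x + Y x) powr p \<le> a powr p + p * (p - 1) * ((a + b) powr (p - 2) * b\<^sup>2)"
proof -
  have X: "X \<in> Lp M p M"
    using assms Lp_subset by blast
  have p: "1 \<le> p" "1 < p" "0 < p"
    using assms by auto
  let ?S = "\<lambda>x. sgn (X x) * \<bar>X x\<bar> powr (p - 1) * Y x"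
  let ?R = "\<lambda>x. (\<bar>X x\<bar> + \<bar>Y x\<bar>) powr (p - 2) * (Y x)\<^sup>2"
  have S: "integrable M ?S" "(\<integral>x. ?S x \<partial>M) = 0"
    using integral_sgn_powr_mult_eq_0[OF assms(1) p(2) assms(3-5)] by auto
  have "Lp_norm M p (\<lambda>x. \<bar>X x\<bar> + \<bar>Y x\<bar>) \<le> a + b"
    using Lp_norm_add_le[OF p(1) Lp_abs[OF X] Lp_abs[OF assms(4)]] assms by (simp add: Lp_norm_abs)
  then have R: "integrable M ?R" "(\<integral>x. ?R x \<partial>M) \<le> (a + b) powr (p - 2) * b\<^sup>2"
    using integral_powr_square_le[OF assms(2) Lp_add[OF p(1) Lp_abs[OF X] Lp_abs[OF assms(4)]] assms(4), of "a + b" b]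
      assms by auto
  have "Lp_norm M p (\<lambda>x. X x + Y x) powr p = (\<integral>x. \<bar>X x + Y x\<bar> powr p \<partial>M)"
    using p by (simp add: Lp_norm_powr)
  also have "\<dots> \<le> (\<integral>x. \<bar>X x\<bar> powr p + p * ?S x + p * (p - 1) * ?R x \<partial>M)"
  proof (rule integral_mono)
    show "integrable M (\<lambda>x. \<bar>X x + Y x\<bar> powr p)"
      by (rule Lp_integrable_powr[OF Lp_add[OF p(1) X assms(4)]])
    show "integrable M (\<lambda>x. \<bar>X x\<bar> powr p + p * ?S x + p * (p - 1) * ?R x)"
      using S R Lp_integrable_powr[OF X] by (intro Bochner_Integration.integrable_add integrable_mult_right)
    show "\<bar>X x + Y x\<bar> powr p \<le> \<bar>X x\<bar> powr p + p * ?S x + p * (p - 1) * ?R x" for x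
      using abs_powr_add_le[OF assms(2)] by simp
  qed
  also have "\<dots> = (\<integral>x. \<bar>X x\<bar> powr p \<partial>M) + p * (\<integral>x. ?S x \<partial>M) + p * (p - 1) * (\<integral>x. ?R x \<partial>M)"
    using S(1) R(1) Lp_integrable_powr[OF X]
    by (simp only: Bochner_Integration.integral_add Bochner_Integration.integrable_add
        integrable_mult_right integral_mult_right_zero)
  also have "\<dots> \<le> a powr p + p * (p - 1) * ((a + b) powr (p - 2) * b\<^sup>2)"
    using S(2) R(2) integral_powr_le[OF p(3) assms(8)] assms by (intro add_mono mult_left_mono) auto
  finally show ?thesis .
qed

text \<open>A Burkholder type inequality with an explicit constant. The square of the bound grows by
  \<open>4 * p * b\<^sup>2\<close> with each difference, and \<open>powr_step_le\<close> says that
  this growth suffices once \<open>Suc n\<close> exceeds \<open>4 * p\<close>.\<close>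

lemma (in finite_measure) Lp_norm_martingale_le:
  fixes D :: "nat \<Rightarrow> 'a \<Rightarrow> real" and G :: "nat \<Rightarrow> 'a measure"
  assumes "2 \<le> p" and sub: "\<And>k. subalgebra M (G k)"
    and mono: "\<And>k l. k \<le> l \<Longrightarrow> sets (G k) \<subseteq> sets (G l)"
    and D: "\<And>k. D k \<in> Lp_minus M p (G (Suc k)) (G k)"
    and b: "\<And>k. Lp_norm M p (D k) \<le> b"
  shows "Lp_norm M p (\<lambda>x. \<Sum>k<n. D k x) \<le> 2 * sqrt p * sqrt n * b"
proof (cases "n = 0")
  case False
  have p: "1 \<le> p" "0 < p"
    using assms by auto
  have DG: "D k \<in> Lp M p (G (Suc k))" for k
    using D by (auto simp: Lp_minus_def)
  then have DM: "D k \<in> Lp M p M" for k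
    using Lp_subset by blast
  \<comment> \<open>The martingale step needs a positive bound, while \<open>b\<close> may be 0; so
    the induction runs for every positive \<open>c\<close> with \<open>b \<le> c\<close>, and
    \<open>b\<close> is recovered at the end by density.\<close>
  have bound: "Lp_norm M p (\<lambda>x. \<Sum>k<n. D k x) \<le> 2 * sqrt p * sqrt n * c" if c: "0 < c" "b \<le> c" for c n
  proof (induction n)
    case 0
    then show ?case
      by (simp add: Lp_norm_zero)
  next
    case (Suc n)
    show ?case
    proof (cases "Suc n \<le> 4 * p")
      case True
      have "Lp_norm M p (\<lambda>x. \<Sum>k<Suc n. D k x) \<le> (\<Sum>k<Suc n. Lp_norm M p (D k))"
        by (intro Lp_norm_sum_le p DM)
      also have "\<dots> \<le> (\<Sum>k<Suc n. c)"
        using b c by (intro sum_mono) (auto intro: order_trans)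
      also have "\<dots> = sqrt (Suc n) * sqrt (Suc n) * c"
        by simp
      also have "\<dots> \<le> sqrt (4 * p) * sqrt (Suc n) * c"
        using True c by (intro mult_right_mono real_sqrt_le_mono) auto
      finally show ?thesis
        by (simp add: real_sqrt_mult)
    next
      case False
      \<comment> \<open>\<open>r\<close> is the inductive bound in units of \<open>c\<close>. From
        \<open>Suc n > 4 * p\<close> follows \<open>p \<le> n\<close>, which gives the condition
        \<open>2 * p \<le> r\<close> of \<open>powr_step_le\<close>.\<close>
      define r where "r = 2 * sqrt p * sqrt n"
      have r_sq: "r\<^sup>2 = 4 * p * n"
        using p by (simp add: r_def power_mult_distrib)
      have "(2 * p)\<^sup>2 = 4 * p * p"
        by (simp add: power2_eq_square)
      also have "\<dots> \<le> r\<^sup>2"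
        unfolding r_sq using False assms(1) by (intro mult_left_mono) auto
      finally have r: "2 * p \<le> r"
        by (rule power2_le_imp_le) (simp add: r_def p less_imp_le)
      have XG: "(\<lambda>x. \<Sum>k<n. D k x) \<in> Lp M p (G n)"
      proof (rule Lp_sum[OF p(1)])
        fix k assume "k \<in> {..<n}"
        then show "D k \<in> Lp M p (G n)"
          using DG[of k] Lp_mono[OF sub sub mono, of "Suc k" n] by auto
      qed
      have "Lp_norm M p (\<lambda>x. (\<Sum>k<n. D k x) + D n x) powr p
          \<le> (r * c) powr p + p * (p - 1) * ((r * c + c) powr (p - 2) * c\<^sup>2)"
        using D[of n] b[of n] Suc c r p
        by (intro Lp_martingale_step[OF sub assms(1) XG DM]) (auto simp: Lp_minus_def r_def)
      also have "\<dots> = c powr p * (r powr p + p * (p - 1) * (r + 1) powr (p - 2))"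
      proof -
        have "(r * c + c) powr (p - 2) = ((r + 1) * c) powr (p - 2)"
          by (simp add: algebra_simps)
        also have "\<dots> = (r + 1) powr (p - 2) * c powr (p - 2)"
          by (rule powr_mult)
        finally have "(r * c + c) powr (p - 2) = (r + 1) powr (p - 2) * c powr (p - 2)" .
        moreover have "c powr (p - 2) * c\<^sup>2 = c powr p"
          using powr_add[of c "p - 2" 2] c by (simp add: powr_numeral)
        ultimately have "(r * c + c) powr (p - 2) * c\<^sup>2 = (r + 1) powr (p - 2) * c powr p"
          by simp
        moreover have "(r * c) powr p = r powr p * c powr p"
          by (rule powr_mult)
        ultimately show ?thesis
          by (simp add: algebra_simps)
      qed
      also have "\<dots> \<le> c powr p * (r\<^sup>2 + 4 * p) powr (p / 2)"
        using assms(1) r by (intro mult_left_mono powr_step_le) auto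
      also have "r\<^sup>2 + 4 * p = (2 * sqrt p * sqrt (Suc n))\<^sup>2"
        using p by (simp add: r_sq power_mult_distrib algebra_simps)
      also have "c powr p * ((2 * sqrt p * sqrt (Suc n))\<^sup>2) powr (p / 2) = (2 * sqrt p * sqrt (Suc n) * c) powr p"
        using p by (simp add: power2_powr_half powr_mult del: of_nat_Suc)
      finally show ?thesis
        using p c by (intro Lp_norm_leI) (auto simp: Lp_norm_powr)
    qed
  qed
  have "Lp_norm M p (\<lambda>x. \<Sum>k<n. D k x) / (2 * sqrt p * sqrt n) \<le> b"
  proof (rule dense_ge)
    fix c assume "b < c"
    then show "Lp_norm M p (\<lambda>x. \<Sum>k<n. D k x) / (2 * sqrt p * sqrt n) \<le> c"
      using bound[of c n] False p Lp_norm_nonneg[of M p "D 0"] b[of 0] by (simp add: field_simps)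
  qed
  then show ?thesis
    using False p by (simp add: field_simps)
qed (simp add: Lp_norm_zero)

text \<open>The laws of the action hold only on \<open>space M\<close>; this lemma and the next
  carry identities proved there over to \<open>Lp\<close> and its norm.\<close>

lemma Lp_cong_space:
  assumes "\<And>x. x \<in> space M \<Longrightarrow> f x = h x"
  shows "f \<in> Lp M p M \<longleftrightarrow> h \<in> Lp M p M"
  using measurable_cong[of M f h borel]
    Bochner_Integration.integrable_cong[of M M "\<lambda>x. \<bar>f x\<bar> powr p" "\<lambda>x. \<bar>h x\<bar> powr p"] assms
  by (simp add: Lp_iff)

lemma Lp_norm_cong_space:
  assumes "\<And>x. x \<in> space M \<Longrightarrow> f x = h x"
  shows "Lp_norm M p f = Lp_norm M p h"
  unfolding Lp_norm_def using assms by (auto intro!: arg_cong[where f = "\<lambda>z. z powr _"] Bochner_Integration.integral_cong)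

text \<open>Linearity of conditional expectation. It makes sums over the other directions martingale
  differences again in a given direction.\<close>

lemma (in finite_measure) Lp_minus_sum:
  assumes "subalgebra M G" "1 \<le> p" "\<And>i. i \<in> I \<Longrightarrow> h i \<in> Lp_minus M p H G"
  shows "(\<lambda>x. \<Sum>i\<in>I. h i x) \<in> Lp_minus M p H G"
proof -
  interpret G: finite_measure_subalgebra M G
    by unfold_locales fact
  have Lp: "h i \<in> Lp M p H" "AE x in M. real_cond_exp M G (h i) x = 0" if "i \<in> I" for i
    using assms(3)[OF that] by (auto simp: Lp_minus_def)
  have "AE x in M. real_cond_exp M G (\<lambda>x. \<Sum>i\<in>I. h i x) x = 0"
    using Lp
  proof (induction I rule: infinite_finite_induct)
    case (insert i I)
    have "integrable M (h j)" if "j \<in> insert i I" for j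
      using insert(4)[OF that] by (rule Lp_integrable[OF assms(2)])
    then have "integrable M (h i)" "integrable M (\<lambda>x. \<Sum>i\<in>I. h i x)"
      by auto
    from G.real_cond_exp_add[OF this] have
      "AE x in M. real_cond_exp M G (\<lambda>x. \<Sum>i\<in>insert i I. h i x) x
        = real_cond_exp M G (h i) x + real_cond_exp M G (\<lambda>x. \<Sum>i\<in>I. h i x) x"
      using insert by simp
    moreover have "AE x in M. real_cond_exp M G (\<lambda>x. \<Sum>i\<in>I. h i x) x = 0"
      using insert by blast
    ultimately show ?case
      using insert(5)[of i] by (auto elim: AE_mp)
  qed (use G.real_cond_exp_F_meas[of "\<lambda>_. 0"] in simp_all)
  then show ?thesis
    using Lp_sum[OF assms(2) Lp(1)] by (simp add: Lp_minus_def)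
qed

section \<open>Translations as isometries of Lp\<close>

context mp_action
begin

lemma T_space: "x \<in> space M \<Longrightarrow> T i x \<in> space M"
  using measurable_space[OF T_measurable] by blast

lemma T_commute: "x \<in> space M \<Longrightarrow> T i (T j x) = T j (T i x)"
  by (metis T_add add.commute)

lemma T_cancel: "x \<in> space M \<Longrightarrow> T (- i) (T i x) = x"
  by (metis T_add T_zero left_minus)

lemma AE_T: "AE x in M. P x \<Longrightarrow> AE x in M. P (T i x)"
  using AE_distrD[OF T_measurable[of i], where P = P] unfolding T_preserving .

lemma integrable_T: "integrable M h \<Longrightarrow> integrable M (\<lambda>x. h (T i x))" for h :: "'a \<Rightarrow> real"
  using integrable_distr[OF T_measurable[of i], of h] by (simp add: T_preserving)

lemma integral_T: "h \<in> borel_measurable M \<Longrightarrow> (\<integral>x. h (T i x) \<partial>M) = (\<integral>x. h x \<partial>M)" for h :: "'a \<Rightarrow> real"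
  using integral_distr[OF T_measurable[of i], of h] by (simp add: T_preserving)

lemma Lp_T: "h \<in> Lp M p M \<Longrightarrow> (\<lambda>x. h (T i x)) \<in> Lp M p M"
  using measurable_compose[OF T_measurable[of i], of h] integrable_T[of "\<lambda>x. \<bar>h x\<bar> powr p" i]
  by (auto simp: Lp_iff)

lemma Lp_norm_T: "h \<in> borel_measurable M \<Longrightarrow> Lp_norm M p (\<lambda>x. h (T i x)) = Lp_norm M p h"
  using integral_T[of "\<lambda>x. \<bar>h x\<bar> powr p" i] by (simp add: Lp_norm_def)

lemma I_minus_U_apply: "x \<in> space M \<Longrightarrow> I_minus_U M T q h x = h x - h (T (axis q 1) x)"
  by (simp add: I_minus_U_def U_def)

lemma Lp_I_minus_U:
  assumes "1 \<le> p" "h \<in> Lp M p M"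
  shows "I_minus_U M T q h \<in> Lp M p M"
proof -
  have "(\<lambda>x. h x + - h (T (axis q 1) x)) \<in> Lp M p M"
    by (intro Lp_add Lp_uminus Lp_T assms)
  then show ?thesis
    by (subst Lp_cong_space[where h = "\<lambda>x. h x + - h (T (axis q 1) x)"])
      (simp_all add: I_minus_U_apply)
qed

lemma Lp_op_prod:
  assumes "1 \<le> p" "finite R" "h \<in> Lp M p M"
  shows "op_prod (I_minus_U M T) R h \<in> Lp M p M"
  using assms(2)
  by induction (simp_all add: op_prod_empty op_prod_insert[OF I_minus_U_commute] assms Lp_I_minus_U)

end

section \<open>Directional filtrations under translation\<close>

text \<open>The translation law is stated with preimages, which is the form that measurability of
  \<open>T i\<close> asks for; \<open>mp_action_filtrationI\<close> derives it from the form with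
  images.\<close>

locale mp_action_filtration = mp_action M T
  for M :: "'a measure" and T :: "int ^ 'd \<Rightarrow> 'a \<Rightarrow> 'a" +
  fixes F :: "int ^ 'd \<Rightarrow> 'a measure"
  assumes subalgebra_F: "subalgebra M (F i)"
    and vimage_T: "A \<in> sets (F j) \<Longrightarrow> T i -` A \<inter> space M \<in> sets (F (i + j))"
begin

lemma sets_F_subset: "(\<Union>i\<in>I. sets (F i)) \<subseteq> sets M"
  using subalgebra_F by (auto simp: subalgebra_def)

lemma sets_F_Pow: "(\<Union>i\<in>I. sets (F i)) \<subseteq> Pow (space M)"
  using sets_F_subset sets.sets_into_space by blast

lemma space_F_dir: "space (F_dir M F q l) = space M"
  by (simp add: F_dir_def space_measure_of sets_F_Pow)

lemma subalgebra_F_dir: "subalgebra M (F_dir M F q l)"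
  unfolding subalgebra_def space_F_dir F_dir_def
  by (simp add: sets_measure_of sets_F_Pow sets.sigma_sets_subset[OF sets_F_subset])

lemma sets_F_dir_mono: "l \<le> m \<Longrightarrow> sets (F_dir M F q l) \<subseteq> sets (F_dir M F q m)"
  unfolding F_dir_def sets_measure_of[OF sets_F_Pow] by (intro sigma_sets_mono' UN_mono) auto

text \<open>It suffices to check generators: for \<open>j $ q \<le> l\<close> a set of
  \<open>F j\<close> is pulled back into \<open>F (i + j)\<close>, whose index has
  \<open>q\<close>-th coordinate at most \<open>l + i $ q\<close>.\<close>

lemma T_measurable_F_dir: "T i \<in> measurable (F_dir M F q (l + i $ q)) (F_dir M F q l)"
proof -
  have "T i -` A \<inter> space M \<in> sets (F_dir M F q (l + i $ q))"
    if "j $ q \<le> l" "A \<in> sets (F j)" for j A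
    unfolding F_dir_def sets_measure_of[OF sets_F_Pow]
    using that vimage_T[of A j i] by (intro sigma_sets.Basic) (auto intro!: exI[of _ "i + j"])
  then have "T i \<in> measurable (F_dir M F q (l + i $ q)) (sigma (space M) (\<Union>j\<in>{j. j $ q \<le> l}. sets (F j)))"
    by (intro measurable_measure_of) (auto simp: space_F_dir T_space sets_F_Pow intro: sets_F_Pow[THEN subsetD])
  then show ?thesis
    by (simp add: F_dir_def)
qed

text \<open>By change of variables, the integral of the translate over a set of level
  \<open>m + i $ q\<close> equals that of \<open>h\<close> over a set of level \<open>m\<close>,
  which vanishes. Translations with \<open>i $ q = 0\<close> therefore keep both levels.\<close>

lemma Lp_minus_T:
  assumes "1 \<le> p" "h \<in> Lp_minus M p (F_dir M F q l) (F_dir M F q m)"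
  shows "(\<lambda>x. h (T i x)) \<in> Lp_minus M p (F_dir M F q (l + i $ q)) (F_dir M F q (m + i $ q))"
proof -
  have h: "h \<in> Lp M p (F_dir M F q l)" "AE x in M. real_cond_exp M (F_dir M F q m) h x = 0"
    using assms by (auto simp: Lp_minus_def)
  then have hM: "h \<in> Lp M p M"
    using Lp_subset by blast
  have [measurable]: "h \<in> borel_measurable M"
    using hM by (rule Lp_measurable)
  obtain h' where h': "h' \<in> borel_measurable (F_dir M F q l)" "AE x in M. h x = h' x"
    using h by (auto simp: Lp_def ae_measurable_def)
  have "ae_measurable M (F_dir M F q (l + i $ q)) (\<lambda>x. h (T i x))"
    unfolding ae_measurable_def
  proof (rule bexI)
    show "AE x in M. h (T i x) = h' (T i x)"
      by (rule AE_T[OF h'(2)])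
    show "(\<lambda>x. h' (T i x)) \<in> borel_measurable (F_dir M F q (l + i $ q))"
      by (rule measurable_compose[OF T_measurable_F_dir h'(1)])
  qed
  then have "(\<lambda>x. h (T i x)) \<in> Lp M p (F_dir M F q (l + i $ q))"
    using Lp_T[OF hM, of i] by (auto simp: Lp_def)
  moreover have "AE x in M. real_cond_exp M (F_dir M F q (m + i $ q)) (\<lambda>x. h (T i x)) x = 0"
  proof -
    interpret G: finite_measure_subalgebra M "F_dir M F q m"
      by unfold_locales (rule subalgebra_F_dir)
    interpret G': finite_measure_subalgebra M "F_dir M F q (m + i $ q)"
      by unfold_locales (rule subalgebra_F_dir)
    show ?thesis
    proof (rule G'.real_cond_exp_charact)
      fix A assume A: "A \<in> sets (F_dir M F q (m + i $ q))"
      \<comment> \<open>For this \<open>B\<close>, a point \<open>x\<close> of the space lies in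
        \<open>A\<close> exactly if \<open>T i x\<close> lies in \<open>B\<close>; pulling back by
        \<open>- i\<close> lowers the level from \<open>m + i $ q\<close> to
        \<open>m\<close>.\<close>
      define B where "B = T (- i) -` A \<inter> space M"
      have B: "B \<in> sets (F_dir M F q m)"
        using measurable_sets[OF T_measurable_F_dir[of "- i" q "m + i $ q"] A]
        by (simp add: B_def space_F_dir)
      then have [measurable]: "B \<in> sets M"
        using G.subalg by (auto simp: subalgebra_def)
      have "(\<integral>x\<in>A. h (T i x) \<partial>M) = (\<integral>x. indicator B (T i x) * h (T i x) \<partial>M)"
        unfolding set_lebesgue_integral_def
        by (rule Bochner_Integration.integral_cong) (auto simp: B_def T_cancel T_space indicator_def)
      also have "\<dots> = (\<integral>x\<in>B. h x \<partial>M)"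
        unfolding set_lebesgue_integral_def using integral_T[of "\<lambda>x. indicator B x * h x" i] by simp
      also have "\<dots> = (\<integral>x\<in>B. real_cond_exp M (F_dir M F q m) h x \<partial>M)"
        using Lp_integrable[OF assms(1) hM] B by (rule G.real_cond_exp_intA)
      also have "\<dots> = (\<integral>x. 0 \<partial>M)"
        unfolding set_lebesgue_integral_def
        by (rule integral_cong_AE) (use h(2) in \<open>auto elim: AE_mp\<close>)
      finally show "(\<integral>x\<in>A. h (T i x) \<partial>M) = (\<integral>x\<in>A. 0 \<partial>M)"
        by simp
    qed (use Lp_integrable[OF assms(1) Lp_T[OF hM]] in auto)
  qed
  ultimately show ?thesis
    by (simp add: Lp_minus_def)
qed

end

section \<open>Sums over boxes, one direction at a time\<close>

text \<open>Coordinates outside \<open>S\<close> are fixed at 0, so that the full box is built up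
  direction by direction and translations indexed by a partial box keep the levels of all directions
  outside \<open>S\<close>.\<close>

definition coord_box :: "'d set \<Rightarrow> int ^ 'd \<Rightarrow> (int ^ 'd) set"
  where "coord_box S n = {i. \<forall>q. if q \<in> S then 1 \<le> i $ q \<and> i $ q \<le> n $ q else i $ q = 0}"

definition box_sum :: "(int ^ 'd \<Rightarrow> 'a \<Rightarrow> 'a) \<Rightarrow> 'd set \<Rightarrow> int ^ 'd \<Rightarrow> ('a \<Rightarrow> real) \<Rightarrow> 'a \<Rightarrow> real"
  where "box_sum T S n h x = (\<Sum>i\<in>coord_box S n. h (T i x))"

lemma coord_box_empty: "coord_box {} n = {0}"
  by (auto simp: coord_box_def vec_eq_iff)

lemma coord_box_UNIV: "coord_box UNIV n = {1..n}"
  by (auto simp: coord_box_def less_eq_vec_def)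

text \<open>The new coordinate \<open>Suc k\<close> with \<open>k < nat (n $ q)\<close> runs from 1
  to \<open>n $ q\<close>; for \<open>n $ q \<le> 0\<close> both sets are empty, so the statement
  covers every \<open>n\<close>.\<close>

lemma bij_betw_coord_box_insert:
  assumes "q \<notin> S"
  shows "bij_betw (\<lambda>(k, i). axis q (int (Suc k)) + i) ({..<nat (n $ q)} \<times> coord_box S n) (coord_box (insert q S) n)"
proof (rule bij_betwI[where g = "\<lambda>i. (nat (i $ q) - 1, i - axis q (i $ q))"])
  show "(\<lambda>(k, i). axis q (int (Suc k)) + i) \<in> {..<nat (n $ q)} \<times> coord_box S n \<rightarrow> coord_box (insert q S) n"
  proof safe
    fix k i assume k: "k < nat (n $ q)" and i: "i \<in> coord_box S n"
    have i': "if r \<in> S then 1 \<le> i $ r \<and> i $ r \<le> n $ r else i $ r = 0" for r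
      using i by (simp add: coord_box_def)
    have "if r \<in> insert q S then 1 \<le> (axis q (int (Suc k)) + i) $ r \<and> (axis q (int (Suc k)) + i) $ r \<le> n $ r
        else (axis q (int (Suc k)) + i) $ r = 0" for r
      using i'[of r] k assms by (cases "r = q") (auto simp: axis_def)
    then show "axis q (int (Suc k)) + i \<in> coord_box (insert q S) n"
      unfolding coord_box_def by blast
  qed
  show "(\<lambda>i. (nat (i $ q) - 1, i - axis q (i $ q))) \<in> coord_box (insert q S) n \<rightarrow> {..<nat (n $ q)} \<times> coord_box S n"
  proof
    fix i assume i: "i \<in> coord_box (insert q S) n"
    have i': "if r \<in> insert q S then 1 \<le> i $ r \<and> i $ r \<le> n $ r else i $ r = 0" for r
      using i by (simp add: coord_box_def)
    have "if r \<in> S then 1 \<le> (i - axis q (i $ q)) $ r \<and> (i - axis q (i $ q)) $ r \<le> n $ r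
        else (i - axis q (i $ q)) $ r = 0" for r
      using i'[of r] assms by (cases "r = q") (auto simp: axis_def)
    then have "i - axis q (i $ q) \<in> coord_box S n"
      unfolding coord_box_def by blast
    then show "(nat (i $ q) - 1, i - axis q (i $ q)) \<in> {..<nat (n $ q)} \<times> coord_box S n"
      using i'[of q] by auto
  qed
  show "(\<lambda>i. (nat (i $ q) - 1, i - axis q (i $ q))) ((\<lambda>(k, i). axis q (int (Suc k)) + i) z) = z"
    if z: "z \<in> {..<nat (n $ q)} \<times> coord_box S n" for z
  proof -
    obtain k i where z_eq: "z = (k, i)"
      by fastforce
    have "i $ q = 0"
      using z assms by (auto simp: z_eq coord_box_def)
    then show ?thesis
      by (simp add: z_eq axis_def)
  qed
  show "(\<lambda>(k, i). axis q (int (Suc k)) + i) ((\<lambda>i. (nat (i $ q) - 1, i - axis q (i $ q))) i) = i"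
    if "i \<in> coord_box (insert q S) n" for i
  proof -
    have "1 \<le> i $ q"
      using that by (auto simp: coord_box_def)
    then show ?thesis
      by (simp add: of_nat_diff)
  qed
qed

lemma finite_coord_box: "finite (coord_box S n)" for n :: "int ^ 'd"
proof -
  have "finite S"
    by simp
  then show ?thesis
  proof induction
    case (insert q S)
    then show ?case
      using bij_betw_finite[OF bij_betw_coord_box_insert[of q S n]] by simp
  qed (simp add: coord_box_empty)
qed

context mp_action
begin

lemma box_sum_empty: "x \<in> space M \<Longrightarrow> box_sum T {} n h x = h x"
  by (simp add: box_sum_def coord_box_empty T_zero)

lemma box_sum_insert:
  assumes "q \<notin> S" "x \<in> space M"
  shows "box_sum T (insert q S) n h x = (\<Sum>k<nat (n $ q). box_sum T S n h (T (axis q (int (Suc k))) x))"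
proof -
  have "box_sum T (insert q S) n h x
      = (\<Sum>(k, i)\<in>{..<nat (n $ q)} \<times> coord_box S n. h (T (axis q (int (Suc k)) + i) x))"
    unfolding box_sum_def
    by (subst sum.reindex_bij_betw[OF bij_betw_coord_box_insert[OF assms(1)], symmetric])
      (simp add: case_prod_unfold)
  also have "\<dots> = (\<Sum>k<nat (n $ q). \<Sum>i\<in>coord_box S n. h (T i (T (axis q (int (Suc k))) x)))"
    by (simp only: sum.cartesian_product add.commute[of "axis q _"] T_add[OF assms(2)])
  finally show ?thesis
    by (simp add: box_sum_def)
qed

lemma Lp_box_sum: "1 \<le> p \<Longrightarrow> h \<in> Lp M p M \<Longrightarrow> box_sum T S n h \<in> Lp M p M"
  unfolding box_sum_def[abs_def] by (intro Lp_sum Lp_T)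

text \<open>Telescoping in direction \<open>q\<close>: the slices 1 to \<open>nat (n $ q)\<close>,
  each minus its successor, leave the first slice and the one just past the end.\<close>

lemma box_sum_I_minus_U:
  assumes "q \<notin> S" "x \<in> space M"
  shows "box_sum T (insert q S) n (I_minus_U M T q h) x
    = box_sum T S n h (T (axis q 1) x) - box_sum T S n h (T (axis q (int (Suc (nat (n $ q))))) x)"
proof -
  have diff: "box_sum T S n (I_minus_U M T q h) y = box_sum T S n h y - box_sum T S n h (T (axis q 1) y)"
    if "y \<in> space M" for y
    using that by (simp add: box_sum_def I_minus_U_apply T_space sum_subtractf T_commute[of y "axis q 1"])
  have axis: "T (axis q 1) (T (axis q (int k)) x) = T (axis q (int (Suc k))) x" for k
  proof -
    have "axis q (int (Suc k)) = axis q 1 + axis q (int k)"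
      by (simp add: vec_eq_iff axis_def)
    then show ?thesis
      using assms(2) by (simp add: T_add)
  qed
  show ?thesis
    unfolding box_sum_insert[OF assms] diff[OF T_space[OF assms(2)]] axis
    by (subst sum_lessThan_telescope') simp
qed

text \<open>The two boundary terms are translates of one function, so measure preservation gives
  them equal norms; the cost is 2 whatever the length \<open>n $ q\<close>.\<close>

lemma Lp_norm_box_sum_I_minus_U_le:
  assumes "1 \<le> p" "h \<in> Lp M p M" "q \<notin> S"
  shows "Lp_norm M p (box_sum T (insert q S) n (I_minus_U M T q h)) \<le> 2 * Lp_norm M p (box_sum T S n h)"
proof -
  have Lp: "box_sum T S n h \<in> Lp M p M"
    by (rule Lp_box_sum[OF assms(1,2)])
  have "Lp_norm M p (box_sum T (insert q S) n (I_minus_U M T q h))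
      = Lp_norm M p (\<lambda>x. box_sum T S n h (T (axis q 1) x) - box_sum T S n h (T (axis q (int (Suc (nat (n $ q))))) x))"
    by (rule Lp_norm_cong_space) (rule box_sum_I_minus_U[OF assms(3)])
  also have "\<dots> \<le> Lp_norm M p (box_sum T S n h) + Lp_norm M p (box_sum T S n h)"
    using Lp_norm_diff_le[OF assms(1) Lp_T[OF Lp] Lp_T[OF Lp]]
    unfolding Lp_norm_T[OF Lp_measurable[OF Lp]] .
  finally show ?thesis
    by simp
qed

text \<open>Each induction step removes one factor of the operator product together with its
  direction in the box.\<close>

lemma Lp_norm_box_sum_op_prod_le:
  assumes "1 \<le> p" "h \<in> Lp M p M" "finite R" "R \<inter> S = {}"
  shows "Lp_norm M p (box_sum T (R \<union> S) n (op_prod (I_minus_U M T) R h)) \<le> 2 ^ card R * Lp_norm M p (box_sum T S n h)"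
  using assms(3,4)
proof (induction R)
  case empty
  then show ?case
    by (simp add: op_prod_empty)
next
  case (insert q R)
  let ?h = "op_prod (I_minus_U M T) R h"
  have "Lp_norm M p (box_sum T (insert q R \<union> S) n (op_prod (I_minus_U M T) (insert q R) h))
      \<le> 2 * Lp_norm M p (box_sum T (R \<union> S) n ?h)"
    using Lp_norm_box_sum_I_minus_U_le[of p ?h q "R \<union> S" n] insert
    by (simp add: op_prod_insert[OF I_minus_U_commute] assms Lp_op_prod)
  also have "\<dots> \<le> 2 * (2 ^ card R * Lp_norm M p (box_sum T S n h))"
    using insert by simp
  finally show ?case
    using insert by simp
qed

end

text \<open>Induction on \<open>S\<close>: the slices along a new direction \<open>q\<close> are
  translates of the box sum over \<open>S\<close> and form martingale differences in direction
  \<open>q\<close>, so \<open>Lp_norm_martingale_le\<close> contributes one factor.\<close>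

lemma (in mp_action_filtration) Lp_norm_box_sum_le:
  assumes "2 \<le> p" "finite S" "h \<in> Lp M p M"
    and "\<And>q. q \<in> S \<Longrightarrow> h \<in> Lp_minus M p (F_dir M F q 0) (F_dir M F q (- 1))"
  shows "Lp_norm M p (box_sum T S n h) \<le> (\<Prod>q\<in>S. 2 * sqrt p * sqrt (nat (n $ q))) * Lp_norm M p h"
  using assms(2,4)
proof (induction S)
  case empty
  have "Lp_norm M p (box_sum T {} n h) = Lp_norm M p h"
    by (rule Lp_norm_cong_space) (rule box_sum_empty)
  then show ?case
    by simp
next
  case (insert q S)
  have p: "1 \<le> p"
    using assms by simp
  define D where "D k x = box_sum T S n h (T (axis q (int (Suc k))) x)" for k x
  \<comment> \<open>Indices in the box of \<open>S\<close> have \<open>q\<close>-th coordinate 0, so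
    the translates stay at the levels 0 and -1 of \<open>h\<close>, and so does their sum.\<close>
  have box: "box_sum T S n h \<in> Lp_minus M p (F_dir M F q 0) (F_dir M F q (- 1))"
    unfolding box_sum_def[abs_def]
  proof (rule Lp_minus_sum[OF subalgebra_F_dir p])
    fix i assume "i \<in> coord_box S n"
    then have "i $ q = 0"
      using insert(2) by (auto simp: coord_box_def)
    then show "(\<lambda>x. h (T i x)) \<in> Lp_minus M p (F_dir M F q 0) (F_dir M F q (- 1))"
      using Lp_minus_T[OF p insert.prems[of q], of i] by simp
  qed
  \<comment> \<open>The shift by \<open>Suc k\<close> turns the levels 0 and -1 into
    \<open>Suc k\<close> and \<open>k\<close>, as the filtration \<open>F_dir M F q (int k)\<close>
    requires.\<close>
  have D: "D k \<in> Lp_minus M p (F_dir M F q (int (Suc k))) (F_dir M F q (int k))" for k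
    using Lp_minus_T[OF p box, of "axis q (int (Suc k))"] by (simp add: D_def[abs_def])
  have D_norm: "Lp_norm M p (D k) \<le> Lp_norm M p (box_sum T S n h)" for k
    unfolding D_def[abs_def] using Lp_norm_T[OF Lp_measurable[OF Lp_box_sum[OF p assms(3)]]] by simp
  have "Lp_norm M p (box_sum T (insert q S) n h) = Lp_norm M p (\<lambda>x. \<Sum>k<nat (n $ q). D k x)"
    by (rule Lp_norm_cong_space) (simp add: box_sum_insert insert D_def)
  also have "\<dots> \<le> 2 * sqrt p * sqrt (nat (n $ q)) * Lp_norm M p (box_sum T S n h)"
    by (rule Lp_norm_martingale_le[where G = "\<lambda>k. F_dir M F q (int k)", OF assms(1) subalgebra_F_dir _ D D_norm])
      (simp add: sets_F_dir_mono)
  also have "\<dots> \<le> 2 * sqrt p * sqrt (nat (n $ q)) * ((\<Prod>q\<in>S. 2 * sqrt p * sqrt (nat (n $ q))) * Lp_norm M p h)"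
    using insert assms(1) by (intro mult_left_mono) auto
  finally show ?case
    using insert by (simp add: mult.assoc)
qed

section \<open>From the hypotheses to the explicit bounds\<close>

text \<open>Since the maps are invertible on \<open>space M\<close>, the preimage under
  \<open>T i\<close> of the image of \<open>B\<close> under \<open>T (- j)\<close> is the image of
  \<open>B\<close> under \<open>T (- (i + j))\<close>.\<close>

lemma mp_action_filtrationI:
  fixes M :: "'a measure" and T :: "int ^ 'd \<Rightarrow> 'a \<Rightarrow> 'a"
  assumes "mp_action M T" "completely_commuting_filtration M T F"
  shows "mp_action_filtration M T F"
proof -
  interpret mp_action M T
    by fact
  have sub: "subalgebra M (F i)" for i
    using assms(2) by (simp add: completely_commuting_filtration_def)
  have "\<exists>F0. subalgebra M F0 \<and> (\<forall>i. sets (F i) = (\<lambda>A. T (- i) ` A) ` sets F0)"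
    using assms(2) unfolding completely_commuting_filtration_def by (elim conjE)
  then obtain F0 where F0: "subalgebra M F0" "\<And>i. sets (F i) = (\<lambda>A. T (- i) ` A) ` sets F0"
    by (elim exE conjE) (simp only:)
  show ?thesis
  proof unfold_locales
    show "subalgebra M (F i)" for i
      by (rule sub)
    fix A i j assume "A \<in> sets (F j)"
    then obtain B where B: "B \<in> sets F0" "A = T (- j) ` B"
      using F0(2) by blast
    have B_space: "B \<subseteq> space M"
      using B F0(1) by (auto simp: subalgebra_def dest: sets.sets_into_space)
    have "T i -` A \<inter> space M = T (- (i + j)) ` B"
    proof (intro equalityI subsetI)
      fix x assume x: "x \<in> T i -` A \<inter> space M"
      then obtain y where y: "y \<in> B" "T i x = T (- j) y"
        using B by auto
      have "x = T (- i) (T (- j) y)"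
        using x T_cancel[of x i] y by simp
      also have "\<dots> = T (- (i + j)) y"
        using y B_space T_add[of y "- i" "- j"] by auto
      finally show "x \<in> T (- (i + j)) ` B"
        using y by blast
    next
      fix x assume "x \<in> T (- (i + j)) ` B"
      then obtain y where y: "y \<in> B" "x = T (- (i + j)) y"
        by blast
      then have "y \<in> space M"
        using B_space by blast
      then have "T i x = T (- j) y"
        using y T_add[of y i "- (i + j)"] by simp
      then show "x \<in> T i -` A \<inter> space M"
        using y B \<open>y \<in> space M\<close> T_space by auto
    qed
    then show "T i -` A \<inter> space M \<in> sets (F (i + j))"
      using F0(2)[of "i + j"] B by simp
  qed
qed

text \<open>As \<open>p\<close> and every \<open>n $ q\<close> are at least 1, a martingale factor
  is at least 2 and dominates the telescoping cost of a direction outside \<open>S\<close>. This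
  leaves \<open>2 ^ CARD('d)\<close> as power of 2, which is below the stated one.\<close>

lemma prod_box_coefficient_le:
  fixes n :: "int ^ 'd"
  assumes "2 \<le> p" "1 \<le> n"
  shows "2 ^ card (- S) * (\<Prod>q\<in>S. 2 * sqrt p * sqrt (nat (n $ q)))
    \<le> 2 ^ (2 * CARD('d)) * p powr (real CARD('d) / 2) * vol n powr (1 / 2)"
proof -
  have n: "1 \<le> n $ q" for q
    using assms(2) by (simp add: less_eq_vec_def)
  let ?c = "\<lambda>q. 2 * sqrt p * sqrt (nat (n $ q))"
  have c: "2 \<le> ?c q" for q
  proof -
    have "1 * 1 \<le> sqrt p * sqrt (nat (n $ q))"
      using assms(1) n[of q] by (intro mult_mono) auto
    then show ?thesis
      by simp
  qed
  have c0: "0 \<le> (\<Prod>q\<in>S. ?c q)"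
    using assms(1) by (intro prod_nonneg) auto
  have "2 ^ card (- S) = (\<Prod>q\<in>- S. 2 :: real)"
    by simp
  also have "\<dots> \<le> (\<Prod>q\<in>- S. ?c q)"
    using c by (intro prod_mono) auto
  finally have "2 ^ card (- S) * (\<Prod>q\<in>S. ?c q) \<le> (\<Prod>q\<in>- S. ?c q) * (\<Prod>q\<in>S. ?c q)"
    by (intro mult_right_mono c0)
  also have "\<dots> = (\<Prod>q\<in>UNIV. ?c q)"
    by (subst prod.union_disjoint[symmetric]) (auto simp: Compl_partition2)
  also have "\<dots> = 2 ^ CARD('d) * sqrt p ^ CARD('d) * (\<Prod>q\<in>UNIV. sqrt (nat (n $ q)))"
    by (simp add: prod.distrib)
  also have "(\<Prod>q\<in>UNIV. sqrt (nat (n $ q))) = sqrt (vol n)"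
  proof -
    have "sqrt (\<Prod>q\<in>A. real_of_int (n $ q)) = (\<Prod>q\<in>A. sqrt (nat (n $ q)))" if "finite A" for A
      using that
    proof induction
      case (insert q A)
      then show ?case
        using n[of q] by (simp add: real_sqrt_mult)
    qed simp
    then show ?thesis
      by (simp add: vol_def)
  qed
  also have "sqrt (vol n) = vol n powr (1 / 2)"
    using n by (intro powr_half_sqrt[symmetric]) (auto simp: vol_def intro!: prod_nonneg intro: order_trans[OF zero_le_one])
  also have "sqrt p ^ CARD('d) = p powr (real CARD('d) / 2)"
    using assms(1) by (simp add: powr_half_sqrt[symmetric] powr_powr flip: powr_realpow)
  also have "2 ^ CARD('d) * p powr (real CARD('d) / 2) * vol n powr (1 / 2)
      \<le> 2 ^ (2 * CARD('d)) * p powr (real CARD('d) / 2) * vol n powr (1 / 2)"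
    by (intro mult_right_mono power_increasing) auto
  finally show ?thesis .
qed

theorem theorem9:
  fixes M :: "'a measure" and T :: "int ^ 'd \<Rightarrow> 'a \<Rightarrow> 'a" and F :: "int ^ 'd \<Rightarrow> 'a measure"
    and p :: real and f :: "'a \<Rightarrow> real" and g :: "'d set \<Rightarrow> 'a \<Rightarrow> real"
  assumes "mp_action M T"
    and "completely_commuting_filtration M T F"
    and "2 \<le> p"
    and "f \<in> Lp M p M"
    and "regular M F f"
    and "\<And>S. g S \<in> Lp M p M"
    and "\<And>S q. q \<in> S \<Longrightarrow> g S \<in> Lp_minus M p (F_dir M F q 0) (F_dir M F q (- 1))"
    and "AE x in M. f x = (\<Sum>S\<in>UNIV. op_prod (I_minus_U M T) (- S) (g S) x)"
  shows "(\<forall>n :: int ^ 'd. 1 \<le> n \<longrightarrow>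
      Lp_norm M p (\<lambda>x. \<Sum>i\<in>{1..n}. U M T i f x)
        \<le> 2 ^ (2 * CARD('d)) * p powr (real CARD('d) / 2) * vol n powr (1 / 2)
          * (\<Sum>S\<in>UNIV. Lp_norm M p (g S))) \<and>
    (\<forall>(n :: int ^ 'd) x. 1 \<le> n \<longrightarrow> 0 < x \<longrightarrow>
      measure M {\<omega> \<in> space M. (\<Sum>i\<in>{1..n}. U M T i f \<omega>) > x * vol n}
        \<le> 2 powr (2 * real CARD('d) * p) * p powr (real CARD('d) * p / 2)
          * (\<Sum>S\<in>UNIV. Lp_norm M p (g S)) powr p * x powr (- p) * vol n powr (- p / 2))"
proof -
  interpret mp_action_filtration M T F
    by (rule mp_action_filtrationI[OF assms(1,2)])
  have p: "1 \<le> p" "0 < p"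
    using assms(3) by auto
  define G where "G = (\<Sum>S\<in>UNIV. Lp_norm M p (g S))"
  define K where "K = 2 ^ (2 * CARD('d)) * p powr (real CARD('d) / 2)"
  have G: "0 \<le> G"
    unfolding G_def by (intro sum_nonneg Lp_norm_nonneg)
  have K: "0 \<le> K"
    by (simp add: K_def)
  define X where "X n = box_sum T UNIV n f" for n
  have U_sum: "(\<Sum>i\<in>{1..n}. U M T i f x) = X n x" if "x \<in> space M" for n x
    using that by (simp add: X_def box_sum_def coord_box_UNIV U_def)
  have X_Lp: "X n \<in> Lp M p M" for n
    unfolding X_def using p assms(4) by (intro Lp_box_sum)
  have norm: "Lp_norm M p (X n) \<le> K * vol n powr (1 / 2) * G" if n: "1 \<le> n" for n
  proof -
    define h where "h S = op_prod (I_minus_U M T) (- S) (g S)" for S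
    have h: "h S \<in> Lp M p M" for S
      unfolding h_def using p assms(6) by (intro Lp_op_prod) auto
    \<comment> \<open>The decomposition of \<open>f\<close> holds only almost everywhere; the box
      gives finitely many translates, so one null set serves for all of them.\<close>
    have "AE x in M. \<forall>i\<in>coord_box UNIV n. f (T i x) = (\<Sum>S\<in>UNIV. h S (T i x))"
      unfolding h_def by (intro AE_finite_allI finite_coord_box AE_T[OF assms(8)])
    then have "AE x in M. X n x = (\<Sum>S\<in>UNIV. box_sum T UNIV n (h S) x)"
    proof eventually_elim
      case (elim x)
      then show ?case
        by (simp add: X_def box_sum_def sum.swap[of _ UNIV])
    qed
    then have "Lp_norm M p (X n) = Lp_norm M p (\<lambda>x. \<Sum>S\<in>UNIV. box_sum T UNIV n (h S) x)"
      using p h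
      by (intro Lp_norm_cong_AE Lp_measurable[OF X_Lp] Lp_measurable[OF Lp_sum[where G = M]] Lp_box_sum)
    also have "\<dots> \<le> (\<Sum>S\<in>UNIV. Lp_norm M p (box_sum T UNIV n (h S)))"
      using p h by (intro Lp_norm_sum_le Lp_box_sum)
    also have "\<dots> \<le> (\<Sum>S\<in>UNIV. K * vol n powr (1 / 2) * Lp_norm M p (g S))"
    proof (rule sum_mono)
      fix S :: "'d set"
      \<comment> \<open>The directions in \<open>- S\<close> are removed by telescoping, those in
        \<open>S\<close> are left to the martingale bound.\<close>
      have "Lp_norm M p (box_sum T UNIV n (h S)) \<le> 2 ^ card (- S) * Lp_norm M p (box_sum T S n (g S))"
        using Lp_norm_box_sum_op_prod_le[OF p(1) assms(6), of "- S" S n S] by (simp add: h_def Compl_partition2)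
      also have "\<dots> \<le> 2 ^ card (- S) * ((\<Prod>q\<in>S. 2 * sqrt p * sqrt (nat (n $ q))) * Lp_norm M p (g S))"
        by (intro mult_left_mono Lp_norm_box_sum_le assms(3,6,7)) auto
      also have "\<dots> \<le> K * vol n powr (1 / 2) * Lp_norm M p (g S)"
        using mult_right_mono[OF prod_box_coefficient_le[OF assms(3) n, of S] Lp_norm_nonneg]
        by (simp add: K_def mult.assoc)
      finally show "Lp_norm M p (box_sum T UNIV n (h S)) \<le> K * vol n powr (1 / 2) * Lp_norm M p (g S)" .
    qed
    also have "\<dots> = K * vol n powr (1 / 2) * G"
      by (simp add: G_def sum_distrib_left)
    finally show ?thesis .
  qed
  have tail: "measure M {\<omega> \<in> space M. X n \<omega> > x * vol n}
      \<le> K powr p * G powr p * x powr (- p) * vol n powr (- p / 2)" if n: "1 \<le> n" and x: "0 < x" for n x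
  proof -
    have v: "0 < vol n"
      using n unfolding vol_def less_eq_vec_def by (intro prod_pos) (auto intro: less_le_trans[OF zero_less_one])
    have [measurable]: "X n \<in> borel_measurable M"
      by (rule Lp_measurable[OF X_Lp])
    \<comment> \<open>The one-sided event is enlarged to a two-sided one for the \<open>p\<close>-th
      power, to which Markov's inequality applies.\<close>
    have "measure M {\<omega> \<in> space M. X n \<omega> > x * vol n}
        \<le> measure M {\<omega> \<in> space M. \<bar>X n \<omega>\<bar> powr p \<ge> (x * vol n) powr p}"
    proof (rule finite_measure_mono)
      show "{\<omega> \<in> space M. X n \<omega> > x * vol n} \<subseteq> {\<omega> \<in> space M. \<bar>X n \<omega>\<bar> powr p \<ge> (x * vol n) powr p}"
        using p x v by (auto intro!: powr_mono2)
    qed measurable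
    also have "\<dots> \<le> (\<integral>\<omega>. \<bar>X n \<omega>\<bar> powr p \<partial>M) / (x * vol n) powr p"
      using x v by (intro integral_Markov_inequality_measure[where A = "space M"] Lp_integrable_powr[OF X_Lp]) auto
    also have "\<dots> \<le> (K * vol n powr (1 / 2) * G) powr p / (x * vol n) powr p"
      using norm[OF n] p by (intro divide_right_mono integral_powr_le) auto
    \<comment> \<open>The norm bound contributes the exponent \<open>p / 2\<close> of
      \<open>vol n\<close> and the threshold the exponent \<open>- p\<close>, in total
      \<open>- p / 2\<close>.\<close>
    also have "\<dots> = K powr p * G powr p * x powr (- p) * (vol n powr (p / 2) * vol n powr (- p))"
      by (simp add: powr_mult powr_powr powr_minus divide_simps)
    also have "vol n powr (p / 2) * vol n powr (- p) = vol n powr (- p / 2)"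
      by (simp flip: powr_add)
    finally show ?thesis .
  qed
  have "K powr p = 2 powr (2 * real CARD('d) * p) * p powr (real CARD('d) * p / 2)"
    using p by (simp add: K_def powr_mult powr_powr flip: powr_realpow)
  with norm tail show ?thesis
    by (simp add: U_sum Lp_norm_cong_space[OF U_sum] G_def[symmetric] K_def[symmetric] cong: conj_cong)
qed

end
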